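(* There exists a universal constant $C>0$ such that for every cell $K$, every edge $\sigma\in\mathcal{E}_K$, every positive discrete density $u$ and every discrete potential $\phi$, $$\tau_\sigma|\mathrm{D}_{K,\sigma}\sqrt u|^2\le C\big(\mathcal{P}_{K,\sigma}[u,\phi]-\mathcal{C}_{K,\sigma}[u,\phi]\big),$$ where $\mathcal{P}_{K,\sigma}[u,\phi]=\mathcal{F}_{K,\sigma}[u,\phi]\,(\mathrm{D}_{K,\sigma}\log u+\mathrm{D}_{K,\sigma}\phi)$ is the edgewise entropy production and $\mathcal{C}_{K,\sigma}[u,\phi]=\tau_\sigma\mathrm{D}_{K,\sigma}u\,\mathrm{D}_{K,\sigma}\phi$ is the cross term.
   Context: $\mathcal{T}$ is a finite-volume mesh with cells $K$; $\mathcal{E}_K$ is the set of edges (faces) of $K$. For a cellwise quantity $v=(v_K)_{K\in\mathcal{T}}$, together with given values $v_\sigma$ on exterior edges, $\mathrm{D}_{K,\sigma}v=v_{K,\sigma}-v_K$, where $v_{K,\sigma}=v_L$ if $\sigma=K|L$ and $v_{K,\sigma}=v_\sigma$ if $\sigma$ is exterior; $\mathrm{D}_{K,\sigma}f(v)=f(v_{K,\sigma})-f(v_K)$. A positive density has $u_K>0$ and $u_{K,\sigma}>0$. $\tau_\sigma=\mathrm{m}(\sigma)/\mathrm{d}_\sigma>0$ is the transmissibility coefficient ($\mathrm{m}(\sigma)$ the measure of $\sigma$; $\mathrm{d}_\sigma=d(x_K,x_L)$ if $\sigma=K|L$, $d(x_K,\sigma)$ if $\sigma$ is exterior, $x_K$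 being the cell points). $B(s)=s/(e^s-1)$ for $s\neq0$, $B(0)=1$. The Scharfetter--Gummel flux is $\mathcal{F}_{K,\sigma}[u,\phi]=\tau_\sigma(B(-\mathrm{D}_{K,\sigma}\phi)u_{K,\sigma}-B(\mathrm{D}_{K,\sigma}\phi)u_K)$. *)

theory Defs
  imports "HOL-Analysis.Analysis"
begin

text \<open>
  The constant in the theorem does not depend on the space dimension, so the dimension has to be
  an ordinary (quantifiable) natural number and not a type. Points of \<open>\<real>\<^sup>d\<close> are therefore the
  extensional functions on \<open>{..<d}\<close>: this is both the carrier of the product topology and the
  carrier of the product Lebesgue measure.
\<close>

type_synonym point = "nat \<Rightarrow> real"

abbreviation rspace :: "nat \<Rightarrow> point set" where
  "rspace d \<equiv> {..<d} \<rightarrow>\<^sub>E UNIV"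

abbreviation rtop :: "nat \<Rightarrow> point topology" where
  "rtop d \<equiv> product_topology (\<lambda>_. euclideanreal) {..<d}"

abbreviation rleb :: "nat \<Rightarrow> point measure" where
  "rleb d \<equiv> completion (PiM {..<d} (\<lambda>_. lborel))"

definition rdist :: "nat \<Rightarrow> point \<Rightarrow> point \<Rightarrow> real" where
  "rdist d x y = L2_set (\<lambda>i. x i - y i) {..<d}"

definition hyperplane :: "nat \<Rightarrow> point \<Rightarrow> real \<Rightarrow> point set" where
  "hyperplane d n b = {x \<in> rspace d. (\<Sum>i<d. n i * x i) = b}"

definition unit_normal :: "nat \<Rightarrow> point set \<Rightarrow> point \<Rightarrow> bool" where
  "unit_normal d S n \<longleftrightarrow>
     n \<in> rspace d \<and> L2_set n {..<d} = 1 \<and> (\<exists>b. S \<subseteq> hyperplane d n b)"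

text \<open>
  The \<open>(d - 1)\<close>-dimensional measure of a subset \<open>S\<close> of a hyperplane is the Lebesgue measure of the
  cylinder of height 1 over \<open>S\<close> in normal direction. If \<open>S\<close> lies in several hyperplanes, then
  every choice of the normal gives 0. For \<open>d = 1\<close> a one-point set has measure 1.
\<close>

definition facet_measure :: "nat \<Rightarrow> point set \<Rightarrow> real" where
  "facet_measure d S =
     (let n = (SOME n. unit_normal d S n) in
      measure (rleb d) ((\<lambda>(x, t). \<lambda>i\<in>{..<d}. x i + t * n i) ` (S \<times> {0..1})))"

record fv_mesh =
  spdim :: nat
  domain :: "point set"
  cells :: "point set set"
  edges :: "point set \<Rightarrow> point set set"
  cpoint :: "point set \<Rightarrow> point"

definition exterior :: "fv_mesh \<Rightarrow> point set \<Rightarrow> bool" where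
  "exterior M \<sigma> \<longleftrightarrow> \<sigma> \<subseteq> rtop (spdim M) frontier_of (domain M)"

definition is_neighbor :: "fv_mesh \<Rightarrow> point set \<Rightarrow> point set \<Rightarrow> point set \<Rightarrow> bool" where
  "is_neighbor M K \<sigma> L \<longleftrightarrow> L \<in> cells M \<and> L \<noteq> K \<and> \<sigma> \<in> edges M L"

text \<open>The cell \<open>L\<close> with \<open>\<sigma> = K|L\<close>, for an interior edge \<open>\<sigma>\<close> of \<open>K\<close>.\<close>

definition neighbor :: "fv_mesh \<Rightarrow> point set \<Rightarrow> point set \<Rightarrow> point set" where
  "neighbor M K \<sigma> = (THE L. is_neighbor M K \<sigma> L)"

definition edge_dist :: "fv_mesh \<Rightarrow> point set \<Rightarrow> point set \<Rightarrow> real" where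
  "edge_dist M K \<sigma> =
     (if exterior M \<sigma> then (INF y\<in>\<sigma>. rdist (spdim M) (cpoint M K) y)
      else rdist (spdim M) (cpoint M K) (cpoint M (neighbor M K \<sigma>)))"

text \<open>
  Cells are open, but need not be convex. No orthogonality condition and no condition on the
  location of the cell points, other than positivity of the distances, is imposed; the usual
  admissible meshes (orthogonality, convex cells, cell points in the closed cells) are special
  cases.
\<close>

definition is_fv_mesh :: "fv_mesh \<Rightarrow> bool" where
  "is_fv_mesh M \<longleftrightarrow>
     (let d = spdim M; X = rtop d in
      d \<ge> 1 \<and>
      openin X (domain M) \<and> domain M \<noteq> {} \<and>
      (\<exists>R. \<forall>x\<in>domain M. L2_set x {..<d} \<le> R) \<and>
      finite (cells M) \<and>
      (\<forall>K\<in>cells M. openin X K \<and> K \<noteq> {} \<and> K \<subseteq> domain M) \<and>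
      pairwise disjnt (cells M) \<and>
      (\<Union>K\<in>cells M. X closure_of K) = X closure_of (domain M) \<and>
      (\<forall>K\<in>cells M. cpoint M K \<in> rspace d) \<and>
      (\<forall>K\<in>cells M.
         finite (edges M K) \<and>
         (\<Union>\<sigma>\<in>edges M K. X closure_of \<sigma>) = X frontier_of K \<and>
         (\<forall>\<sigma>\<in>edges M K. \<forall>\<sigma>'\<in>edges M K. \<sigma> \<noteq> \<sigma>' \<longrightarrow> facet_measure d (\<sigma> \<inter> \<sigma>') = 0) \<and>
         (\<forall>\<sigma>\<in>edges M K.
            (\<exists>n. unit_normal d \<sigma> n) \<and>
            facet_measure d \<sigma> > 0 \<and>
            (\<not> exterior M \<sigma> \<longrightarrow> (\<exists>!L. is_neighbor M K \<sigma> L)) \<and>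
            edge_dist M K \<sigma> > 0)))"

definition transmissibility :: "fv_mesh \<Rightarrow> point set \<Rightarrow> point set \<Rightarrow> real" where
  "transmissibility M K \<sigma> = facet_measure (spdim M) \<sigma> / edge_dist M K \<sigma>"

text \<open>Values on the cells, and values on the exterior edges (used only there).\<close>

record discrete_fun =
  cell_val :: "point set \<Rightarrow> real"
  bdry_val :: "point set \<Rightarrow> real"

definition edge_val :: "fv_mesh \<Rightarrow> discrete_fun \<Rightarrow> point set \<Rightarrow> point set \<Rightarrow> real" where
  "edge_val M v K \<sigma> =
     (if exterior M \<sigma> then bdry_val v \<sigma> else cell_val v (neighbor M K \<sigma>))"

definition diff :: "fv_mesh \<Rightarrow> discrete_fun \<Rightarrow> point set \<Rightarrow> point set \<Rightarrow> real" where
  "diff M v K \<sigma> = edge_val M v K \<sigma> - cell_val v K"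

definition diff_fun ::
    "fv_mesh \<Rightarrow> (real \<Rightarrow> real) \<Rightarrow> discrete_fun \<Rightarrow> point set \<Rightarrow> point set \<Rightarrow> real" where
  "diff_fun M f v K \<sigma> = f (edge_val M v K \<sigma>) - f (cell_val v K)"

definition positive_density :: "fv_mesh \<Rightarrow> discrete_fun \<Rightarrow> bool" where
  "positive_density M u \<longleftrightarrow>
     (\<forall>K\<in>cells M. cell_val u K > 0 \<and> (\<forall>\<sigma>\<in>edges M K. edge_val M u K \<sigma> > 0))"

definition bernoulli_fun :: "real \<Rightarrow> real" where
  "bernoulli_fun s = (if s = 0 then 1 else s / (exp s - 1))"

definition sg_flux ::
    "fv_mesh \<Rightarrow> discrete_fun \<Rightarrow> discrete_fun \<Rightarrow> point set \<Rightarrow> point set \<Rightarrow> real" where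
  "sg_flux M u \<phi> K \<sigma> = transmissibility M K \<sigma> *
     (bernoulli_fun (- diff M \<phi> K \<sigma>) * edge_val M u K \<sigma>
      - bernoulli_fun (diff M \<phi> K \<sigma>) * cell_val u K)"

definition entropy_production ::
    "fv_mesh \<Rightarrow> discrete_fun \<Rightarrow> discrete_fun \<Rightarrow> point set \<Rightarrow> point set \<Rightarrow> real" where
  "entropy_production M u \<phi> K \<sigma> =
     sg_flux M u \<phi> K \<sigma> * (diff_fun M ln u K \<sigma> + diff M \<phi> K \<sigma>)"

definition cross_term ::
    "fv_mesh \<Rightarrow> discrete_fun \<Rightarrow> discrete_fun \<Rightarrow> point set \<Rightarrow> point set \<Rightarrow> real" where
  "cross_term M u \<phi> K \<sigma> = transmissibility M K \<sigma> * diff M u K \<sigma> * diff M \<phi> K \<sigma>"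

end

theory Submission
  imports Defs
begin

text \<open>
  On one edge write \<open>a = u\<^sub>K\<close>, \<open>b = u\<^bsub>K,\<sigma>\<^esub>\<close>, \<open>s = D\<phi>\<close> and \<open>x = ln b - ln a\<close>. Exchanging \<open>a\<close> and
  \<open>b\<close> and changing the sign of \<open>s\<close> preserves the inequality, so let \<open>a \<le> b\<close>. If \<open>s \<ge> 0\<close>, then
  \<open>B(s) \<ge> 1 - s/2\<close> shows that the flux is at least \<open>b - a\<close>, hence the production minus the cross term
  is at least \<open>(b - a) x\<close>. If \<open>s = -t < 0\<close>, the production is nonnegative and the cross term
  contributes \<open>(b - a) t\<close>, which suffices when \<open>t \<ge> x/2\<close> or \<open>t \<ge> 1/2\<close>. In the remaining case
  \<open>t a \<le> (b - a)/2\<close>, so the flux is at least \<open>(b - a)/4\<close> and the production at least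
  \<open>(b - a) x/8\<close>.
\<close>

lemma bernoulli_fun_pos: "bernoulli_fun s > 0"
  by (cases "s > 0"; cases "s = 0") (auto simp: bernoulli_fun_def divide_neg_neg)

lemma bernoulli_fun_minus_eq_add: "bernoulli_fun (- s) = bernoulli_fun s + s"
  by (auto simp: bernoulli_fun_def exp_minus field_simps)

text \<open>This form reveals the sign of the flux; the additive one separates its diffusive part, a
  multiple of \<open>b - a\<close>, from the drift.\<close>

lemma bernoulli_fun_minus_eq_mult: "bernoulli_fun (- s) = exp s * bernoulli_fun s"
  by (auto simp: bernoulli_fun_def exp_minus field_simps)

text \<open>Clearing denominators turns this into \<open>g s \<ge> 0\<close>, where \<open>g\<close>
  vanishes at 0 and its derivative \<open>1 - (1 - r) * exp r\<close> is nonnegative because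
  \<open>1 - r \<le> exp (- r)\<close>.\<close>

lemma bernoulli_fun_ge:
  assumes "s \<ge> 0"
  shows "bernoulli_fun s \<ge> 1 - s / 2"
proof (cases "s = 0")
  case True
  then show ?thesis by (simp add: bernoulli_fun_def)
next
  case False
  define g where "g = (\<lambda>s::real. 2 * s - (2 - s) * (exp s - 1))"
  have "g 0 \<le> g s"
  proof (rule DERIV_nonneg_imp_nondecreasing[OF assms])
    fix r :: real
    have "(1 - r) * exp r \<le> exp (- r) * exp r"
      using exp_ge_add_one_self[of "- r"] by (intro mult_right_mono) auto
    then have "1 - (1 - r) * exp r \<ge> 0"
      by (simp flip: exp_add)
    moreover have "(g has_real_derivative 1 - (1 - r) * exp r) (at r)"
      unfolding g_def by (auto intro!: derivative_eq_intros simp: algebra_simps)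
    ultimately show "\<exists>y. (g has_real_derivative y) (at r) \<and> 0 \<le> y"
      by blast
  qed
  then have "(1 - s / 2) * (exp s - 1) \<le> s"
    by (simp add: g_def field_simps)
  moreover have "exp s - 1 > 0"
    using assms False by simp
  ultimately show ?thesis
    using False by (simp add: bernoulli_fun_def pos_le_divide_eq)
qed

lemma sq_diff_sqrt_le_diff:
  fixes a b :: real
  assumes "0 \<le> a" "a \<le> b"
  shows "(sqrt b - sqrt a)\<^sup>2 \<le> b - a"
proof -
  have "(sqrt b - sqrt a)\<^sup>2 \<le> (sqrt b - sqrt a) * (sqrt b + sqrt a)"
    unfolding power2_eq_square using assms by (intro mult_left_mono) auto
  also have "\<dots> = b - a"
    using assms by (simp add: algebra_simps)
  finally show ?thesis .
qed

text \<open>With \<open>p = sqrt a\<close> and \<open>q = sqrt b\<close>, the bound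
  \<open>ln (p / q) \<le> p / q - 1\<close> makes the logarithmic factor at least
  \<open>2 * (1 - p / q)\<close>, and a second factor \<open>q - p\<close> splits off.\<close>

lemma sq_diff_sqrt_le_diff_mult_ln:
  fixes a b :: real
  assumes "0 < a" "a \<le> b"
  shows "2 * (sqrt b - sqrt a)\<^sup>2 \<le> (b - a) * (ln b - ln a)"
proof -
  define p q where "p = sqrt a" and "q = sqrt b"
  have pq: "0 < p" "p \<le> q" "a = p\<^sup>2" "b = q\<^sup>2"
    using assms by (auto simp: p_def q_def)
  have "ln (p / q) \<le> p / q - 1"
    using pq by (intro ln_le_minus_one) auto
  then have "2 * (1 - p / q) \<le> ln b - ln a"
    using pq by (simp add: ln_div ln_realpow)
  then have "(q\<^sup>2 - p\<^sup>2) * (2 * (1 - p / q)) \<le> (b - a) * (ln b - ln a)"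
    using pq by (simp add: mult_left_mono power_mono)
  moreover have "(q\<^sup>2 - p\<^sup>2) * (2 * (1 - p / q)) = 2 * (q - p)\<^sup>2 * (1 + p / q)"
    using pq by (simp add: field_simps power2_eq_square)
  moreover have "2 * (q - p)\<^sup>2 * 1 \<le> 2 * (q - p)\<^sup>2 * (1 + p / q)"
    using pq by (intro mult_left_mono) auto
  ultimately show ?thesis
    by (simp add: p_def q_def)
qed

lemma sg_edge_estimate_ordered:
  fixes a b s :: real
  assumes a: "0 < a" and ab: "a \<le> b"
  shows "(sqrt b - sqrt a)\<^sup>2
    \<le> 4 * ((bernoulli_fun (- s) * b - bernoulli_fun s * a) * (ln b - ln a + s) - (b - a) * s)"
proof -
  define x where "x = ln b - ln a"
  define F where "F = bernoulli_fun (- s) * b - bernoulli_fun s * a"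
  define D where "D = (sqrt b - sqrt a)\<^sup>2"
  have x: "x \<ge> 0"
    using a ab by (simp add: x_def)
  have D: "0 \<le> D" "D \<le> b - a" "2 * D \<le> (b - a) * x"
    using sq_diff_sqrt_le_diff[of a b] sq_diff_sqrt_le_diff_mult_ln[of a b] a ab
    by (auto simp: D_def x_def)
  have "D \<le> 4 * (F * (x + s) - (b - a) * s)"
  proof (cases "s \<ge> 0")
    case True
    have "(1 - s / 2) * (b - a) \<le> bernoulli_fun s * (b - a)"
      using bernoulli_fun_ge[OF True] ab by (intro mult_right_mono) auto
    moreover have "F = bernoulli_fun s * (b - a) + s * b"
      by (simp add: F_def bernoulli_fun_minus_eq_add algebra_simps)
    \<comment> \<open>The resulting lower bound for \<open>F\<close> is exactly
      \<open>(b - a) + s * (a + b) / 2\<close>.\<close>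
    moreover have "0 \<le> s * (a + b)"
      using True a ab by simp
    ultimately have "b - a \<le> F"
      by (simp add: field_simps)
    then have "(b - a) * (x + s) \<le> F * (x + s)"
      using True x by (intro mult_right_mono) auto
    then have "(b - a) * x \<le> F * (x + s) - (b - a) * s"
      by (simp add: algebra_simps)
    then show ?thesis
      using D by argo
  next
    case False
    define t where "t = - s"
    have t: "t > 0" and s: "s = - t"
      using False by (auto simp: t_def)
    have b: "b = a * exp x"
      using a ab by (simp add: x_def exp_diff)
    \<comment> \<open>Hence \<open>F\<close> has the sign of \<open>x - t\<close>, which makes the
      production nonnegative.\<close>
    have F_mult: "F = bernoulli_fun t * a * (exp x - exp t)"
      by (simp add: F_def s bernoulli_fun_minus_eq_mult b algebra_simps)
    have "0 \<le> (exp x - exp t) * (x - t)"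
      by (cases "t \<le> x") (auto intro: mult_nonpos_nonpos)
    moreover have "0 \<le> bernoulli_fun t * a"
      using a bernoulli_fun_pos[of t] by simp
    ultimately have "0 \<le> (bernoulli_fun t * a) * ((exp x - exp t) * (x - t))"
      by (rule mult_nonneg_nonneg[rotated])
    then have P: "0 \<le> F * (x - t)"
      by (simp add: F_mult mult.assoc)
    have "D \<le> 4 * (F * (x - t) + (b - a) * t)"
    proof -
      consider "x / 2 \<le> t" | "1 / 2 \<le> t" | "t < x / 2" "t < 1 / 2"
        by linarith
      then show ?thesis
      proof cases
        case 1
        then have "(b - a) * (x / 2) \<le> (b - a) * t"
          using ab by (intro mult_left_mono) auto
        then show ?thesis
          using P D by argo
      next
        case 2
        then have "(b - a) * (1 / 2) \<le> (b - a) * t"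
          using ab by (intro mult_left_mono) auto
        then show ?thesis
          using P D by argo
      next
        case 3
        \<comment> \<open>The right-hand side is \<open>b - a\<close>, so \<open>t < x / 2\<close>
          bounds the drift \<open>a * t\<close> by half of it.\<close>
        have "a * x \<le> a * (exp x - 1)"
          using a exp_ge_add_one_self[of x] by (intro mult_left_mono) linarith+
        moreover have "a * t \<le> a * (x / 2)"
          using a 3 by (intro mult_left_mono) auto
        ultimately have ta: "a * t \<le> (b - a) / 2"
          by (simp add: b algebra_simps)
        \<comment> \<open>Here \<open>3 / 4\<close> is \<open>1 - t / 2\<close> at
          \<open>t = 1 / 2\<close>; subtracting the drift leaves \<open>1 / 4\<close>.\<close>
        have "3 / 4 * (b - a) \<le> bernoulli_fun t * (b - a)"
          using bernoulli_fun_ge[of t] t 3 ab by (intro mult_right_mono) auto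
        moreover have "F = bernoulli_fun t * (b - a) - a * t"
          by (simp add: F_def s bernoulli_fun_minus_eq_add algebra_simps)
        ultimately have "(b - a) / 4 \<le> F"
          using ta by argo
        \<comment> \<open>Since \<open>2 * D \<le> (b - a) * x\<close>, the left-hand side is at
          least \<open>D / 4\<close>: the source of the constant 4.\<close>
        then have "(b - a) / 4 * (x / 2) \<le> F * (x - t)"
          using ab x 3 by (intro mult_mono) auto
        moreover have "0 \<le> (b - a) * t"
          using ab t by simp
        ultimately show ?thesis
          using D by argo
      qed
    qed
    then show ?thesis
      by (simp add: s)
  qed
  then show ?thesis
    by (simp add: D_def F_def x_def)
qed

lemma sg_edge_estimate:
  fixes a b s :: real
  assumes "0 < a" "0 < b"
  shows "(sqrt b - sqrt a)\<^sup>2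
    \<le> 4 * ((bernoulli_fun (- s) * b - bernoulli_fun s * a) * (ln b - ln a + s) - (b - a) * s)"
proof (cases "a \<le> b")
  case True
  then show ?thesis
    using assms by (intro sg_edge_estimate_ordered)
next
  case False
  \<comment> \<open>Under the exchange both production factors change sign, as do
    \<open>b - a\<close> and \<open>s\<close>, so both products are preserved.\<close>
  then show ?thesis
    using sg_edge_estimate_ordered[of b a "- s"] assms
    by (simp add: power2_commute[of "sqrt b"] algebra_simps)
qed

lemma transmissibility_pos:
  assumes "is_fv_mesh M" "K \<in> cells M" "\<sigma> \<in> edges M K"
  shows "transmissibility M K \<sigma> > 0"
  using assms unfolding is_fv_mesh_def Let_def transmissibility_def by simp

theorem proposition8:
  shows "\<exists>C::real. C > 0 \<and>
    (\<forall>(M::fv_mesh) K \<sigma> (u::discrete_fun) (\<phi>::discrete_fun).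
       is_fv_mesh M \<longrightarrow> K \<in> cells M \<longrightarrow> \<sigma> \<in> edges M K \<longrightarrow> positive_density M u \<longrightarrow>
       transmissibility M K \<sigma> * \<bar>diff_fun M sqrt u K \<sigma>\<bar>\<^sup>2
         \<le> C * (entropy_production M u \<phi> K \<sigma> - cross_term M u \<phi> K \<sigma>))"
proof (intro exI[of _ "4::real"] conjI allI impI)
  fix M :: fv_mesh and K \<sigma> and u \<phi> :: discrete_fun
  assume M: "is_fv_mesh M" "K \<in> cells M" "\<sigma> \<in> edges M K" and u: "positive_density M u"
  define a b s where "a = cell_val u K" and "b = edge_val M u K \<sigma>" and "s = diff M \<phi> K \<sigma>"
  have "0 < a" "0 < b"
    using M u by (auto simp: positive_density_def a_def b_def)
  then have "transmissibility M K \<sigma> * (sqrt b - sqrt a)\<^sup>2 \<le> transmissibility M K \<sigma> *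
      (4 * ((bernoulli_fun (- s) * b - bernoulli_fun s * a) * (ln b - ln a + s) - (b - a) * s))"
    using transmissibility_pos[OF M] by (intro mult_left_mono sg_edge_estimate) auto
  then show "transmissibility M K \<sigma> * \<bar>diff_fun M sqrt u K \<sigma>\<bar>\<^sup>2
      \<le> 4 * (entropy_production M u \<phi> K \<sigma> - cross_term M u \<phi> K \<sigma>)"
    by (simp add: diff_fun_def entropy_production_def cross_term_def sg_flux_def diff_def[of M u]
        a_def b_def s_def algebra_simps)
qed simp

end
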